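(* Let $d\ge 2$ be an integer, let $Z>0$ be a random variable with distribution function $G$ and Laplace transform $\varphi$, and let $H$ be the distribution function of a max-infinitely divisible law on $\mathbb{R}^d$, so that $H^s$ is a distribution function for every $s>0$. If the parameter $s$ in $H^s$ is randomized by assigning to it the distribution function $G$, then the resulting distribution (the mixture of the laws with distribution functions $H^s$, $s>0$, with mixing distribution $G$) has distribution function $\varphi\{-\log H\}$, i.e. the function $x\mapsto\varphi(-\log H(x))$.
   Context: A distribution function $H$ on $\mathbb{R}^d$ is max-infinitely divisible (MID) iff $H^s$ is a distribution function on $\mathbb{R}^d$ for every $s>0$. The Laplace transform of $Z$ is $\varphi(v)=E[e^{-vZ}]=\int_0^\infty e^{-vs}\,dG(s)$, $v\ge 0$. The formula $\varphi(-\log H(x))$ is considered on the set $\{H>0\}=\{x\in\mathbb{R}^d: H(x)>0\}$, and is read as $0$ where $H(x)=0$ (convention $-\log 0=\infty$, $\varphi(\infty)=0$). *)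

theory Defs
  imports "HOL-Probability.Probability"
begin

text \<open>
  The order on \<open>real ^ 'd\<close> is componentwise, so \<open>{..x}\<close> is the lower orthant
  \<open>{y. \<forall>i. y $ i \<le> x $ i}\<close>.
\<close>

definition has_distribution_function ::
    "(real ^ 'd) measure \<Rightarrow> (real ^ 'd \<Rightarrow> real) \<Rightarrow> bool" where
  "has_distribution_function \<mu> F \<longleftrightarrow>
     prob_space \<mu> \<and> sets \<mu> = sets borel \<and> (\<forall>x. F x = measure \<mu> {..x})"

definition distribution_function :: "(real ^ 'd \<Rightarrow> real) \<Rightarrow> bool" where
  "distribution_function F \<longleftrightarrow> (\<exists>\<mu>. has_distribution_function \<mu> F)"

definition max_infinitely_divisible :: "(real ^ 'd \<Rightarrow> real) \<Rightarrow> bool" where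
  "max_infinitely_divisible H \<longleftrightarrow>
     distribution_function H \<and> (\<forall>s>0. distribution_function (\<lambda>x. H x powr s))"

definition law_of :: "(real ^ 'd \<Rightarrow> real) \<Rightarrow> (real ^ 'd) measure" where
  "law_of F = (THE \<mu>. has_distribution_function \<mu> F)"

definition laplace_transform :: "'a measure \<Rightarrow> ('a \<Rightarrow> real) \<Rightarrow> real \<Rightarrow> real" where
  "laplace_transform M Z v = (\<integral>\<omega>. exp (- v * Z \<omega>) \<partial>M)"

text \<open>
  The mixture of the laws \<open>K s\<close>, \<open>s > 0\<close>, with mixing distribution function \<open>G\<close>. The
  Lebesgue-Stieltjes measure of \<open>G\<close> is restricted to \<open>{0<..}\<close> because the laws are only given
  for positive parameters; this loses no mass when \<open>G\<close> is concentrated on \<open>{0<..}\<close>.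
\<close>

definition mixture :: "(real \<Rightarrow> real) \<Rightarrow> (real \<Rightarrow> 'b measure) \<Rightarrow> 'b measure" where
  "mixture G K = restrict_space (interval_measure G) {0<..} \<bind> K"

text \<open>\<open>\<phi>(- log u)\<close> for \<open>u \<ge> 0\<close>, with the convention \<open>- log 0 = \<infinity>\<close> and \<open>\<phi>(\<infinity>) = 0\<close>.\<close>

definition at_neg_log :: "(real \<Rightarrow> real) \<Rightarrow> real \<Rightarrow> real" where
  "at_neg_log \<phi> u = (if u = 0 then 0 else \<phi> (- ln u))"

lemma has_distribution_function_unique:
  fixes F :: "real ^ 'd \<Rightarrow> real"
  assumes \<mu>: "has_distribution_function \<mu> F" and \<nu>: "has_distribution_function \<nu> F"
  shows "\<mu> = \<nu>"
proof -
  interpret \<mu>: prob_space \<mu> using \<mu> by (simp add: has_distribution_function_def)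
  interpret \<nu>: prob_space \<nu> using \<nu> by (simp add: has_distribution_function_def)
  let ?E = "range (\<lambda>a::real ^ 'd. {..a})"
  let ?A = "\<lambda>n::nat. {..(\<chi> i. real n)::real ^ 'd}"
  have borel: "sets borel = sigma_sets UNIV ?E"
    by (subst borel_eq_atMost) simp
  show ?thesis
  proof (rule measure_eqI_generator_eq[where \<Omega> = UNIV and E = ?E and A = ?A])
    show "Int_stable ?E"
    proof (clarsimp simp: Int_stable_def)
      fix a b :: "real ^ 'd"
      have "{..a} \<inter> {..b} = {..(\<chi> i. min (a $ i) (b $ i))}"
        by (auto simp: less_eq_vec_def)
      then show "{..a} \<inter> {..b} \<in> ?E" by blast
    qed
    show "sets \<mu> = sigma_sets UNIV ?E" "sets \<nu> = sigma_sets UNIV ?E"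
      using \<mu> \<nu> borel by (simp_all add: has_distribution_function_def)
    show "emeasure \<mu> X = emeasure \<nu> X" if "X \<in> ?E" for X
      using that \<mu> \<nu>
      by (auto simp: has_distribution_function_def \<mu>.emeasure_eq_measure \<nu>.emeasure_eq_measure)
    show "(\<Union>n. ?A n) = UNIV"
    proof (intro set_eqI iffI UNIV_I)
      fix y :: "real ^ 'd"
      obtain n where n: "norm y \<le> real n" using real_arch_simple by blast
      have "y $ i \<le> real n" for i
        using component_le_norm_cart[of y i] n by linarith
      then show "y \<in> (\<Union>n. ?A n)" by (auto simp: less_eq_vec_def)
    qed
  qed auto
qed

lemma has_distribution_function_law_of:
  "distribution_function F \<Longrightarrow> has_distribution_function (law_of F) F"
  unfolding distribution_function_def law_of_def
  by (metis theI has_distribution_function_unique)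

end

theory Submission
  imports Defs
begin

text \<open>
  The lower orthants form an intersection-stable generator of the Borel sets, so the kernel
  \<open>s \<mapsto> law_of (H\<^sup>s)\<close> is measurable because \<open>s \<mapsto> H x powr s\<close> is. The mixture gives
  \<open>{..x}\<close> the mass \<open>E[H x powr Z] = E[exp (Z ln (H x))]\<close>, which is the Laplace transform
  of \<open>Z\<close> at \<open>- ln (H x)\<close>; if \<open>H x = 0\<close> it vanishes since \<open>0 powr s = 0\<close>.
\<close>

text \<open>The parameter space \<open>N\<close> is arbitrary so that it can be the open half-line,
  on which the powers of \<open>H\<close> are known to be distribution functions;
  \<open>law_of\<close> is controlled only there.\<close>

lemma measurable_law_of:
  fixes F :: "'b \<Rightarrow> real ^ 'd \<Rightarrow> real"
  assumes F: "\<And>a. a \<in> space N \<Longrightarrow> distribution_function (F a)"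
    and meas: "\<And>x. (\<lambda>a. F a x) \<in> borel_measurable N"
  shows "(\<lambda>a. law_of (F a)) \<in> N \<rightarrow>\<^sub>M prob_algebra borel"
proof (rule measurable_prob_algebra_generated)
  let ?E = "range (\<lambda>a::real ^ 'd. {..a})"
  have law: "has_distribution_function (law_of (F a)) (F a)" if "a \<in> space N" for a
    using F[OF that] by (rule has_distribution_function_law_of)
  show "sets borel = sigma_sets UNIV ?E"
    by (subst borel_eq_atMost) simp
  show "Int_stable ?E"
  proof (clarsimp simp: Int_stable_def)
    fix a b :: "real ^ 'd"
    have "{..a} \<inter> {..b} = {..(\<chi> i. min (a $ i) (b $ i))}"
      by (auto simp: less_eq_vec_def)
    then show "{..a} \<inter> {..b} \<in> ?E" by blast
  qed
  show "prob_space (law_of (F a))" "sets (law_of (F a)) = sets borel" if "a \<in> space N" for a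
    using law[OF that] by (simp_all add: has_distribution_function_def)
  show "(\<lambda>a. emeasure (law_of (F a)) A) \<in> borel_measurable N" if "A \<in> ?E" for A
  proof -
    from that obtain x where A: "A = {..x}" by blast
    have "emeasure (law_of (F a)) A = ennreal (F a x)" if "a \<in> space N" for a
    proof -
      interpret prob_space "law_of (F a)"
        using law[OF that] by (simp add: has_distribution_function_def)
      show ?thesis
        using law[OF that] by (simp add: A has_distribution_function_def emeasure_eq_measure)
    qed
    moreover have "(\<lambda>a. ennreal (F a x)) \<in> borel_measurable N"
      using meas by measurable
    ultimately show ?thesis
      by (subst measurable_cong)
  qed
qed simp

text \<open>Both sides are real distributions with the same distribution function. This turns the
  Stieltjes measure inside \<open>mixture\<close> back into the law of \<open>Z\<close>.\<close>

lemma (in real_distribution) interval_measure_cdf: "interval_measure (cdf M) = M"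
proof (rule cdf_unique)
  show "real_distribution (interval_measure (cdf M))"
    by (intro real_distribution_interval_measure cdf_nondecreasing cdf_is_right_cont
        cdf_lim_at_bot cdf_lim_at_top_prob)
  show "cdf (interval_measure (cdf M)) = cdf M"
    by (intro cdf_interval_measure cdf_nondecreasing cdf_is_right_cont cdf_lim_at_bot)
qed (rule real_distribution_axioms)

text \<open>For \<open>u = 0\<close> the convention \<phi>(\<infinity>) = 0 agrees with
  \<open>0 powr s = 0\<close>, which holds for every \<open>s\<close>, even \<open>s = 0\<close>;
  otherwise \<open>powr\<close> unfolds to the exponential in the transform.\<close>

lemma at_neg_log_laplace_transform:
  "at_neg_log (laplace_transform M Z) u = (\<integral>\<omega>. u powr Z \<omega> \<partial>M)"
  by (simp add: at_neg_log_def laplace_transform_def powr_def mult.commute)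

theorem theorem2:
  fixes H :: "real ^ 'd \<Rightarrow> real"
    and M :: "'a measure" and Z :: "'a \<Rightarrow> real"
    and G \<phi> :: "real \<Rightarrow> real"
  assumes dim: "2 \<le> CARD('d)"
    and "prob_space M"
    and Z: "Z \<in> borel_measurable M" "AE \<omega> in M. 0 < Z \<omega>"
    and G: "G = cdf (distr M borel Z)"
    and \<phi>: "\<phi> = laplace_transform M Z"
    and H: "max_infinitely_divisible H"
  shows "(\<lambda>s. law_of (\<lambda>x. H x powr s)) \<in> restrict_space borel {0<..} \<rightarrow>\<^sub>M prob_algebra borel \<and>
    has_distribution_function (mixture G (\<lambda>s. law_of (\<lambda>x. H x powr s)))
      (\<lambda>x. at_neg_log \<phi> (H x))"
proof
  let ?K = "\<lambda>s. law_of (\<lambda>x. H x powr s)"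
  interpret M: prob_space M by fact
  have df: "distribution_function (\<lambda>x. H x powr s)" if "0 < s" for s
    using H that by (simp add: max_infinitely_divisible_def)
  show K: "?K \<in> restrict_space borel {0<..} \<rightarrow>\<^sub>M prob_algebra borel"
    by (rule measurable_law_of) (simp_all add: space_restrict_space df measurable_restrict_space1)
  have K_cdf: "measure (?K s) {..x} = H x powr s" if "0 < s" for s x
    using has_distribution_function_law_of[OF df[OF that]]
    unfolding has_distribution_function_def by metis
  define D where "D = distr M borel Z"
  interpret D: real_distribution D
    unfolding D_def using Z(1) by (rule M.real_distribution_distr)
  have D_pos: "AE s in D. s \<in> {0<..}"
    unfolding D_def using Z by (subst AE_distr_iff) auto
  define R where "R = restrict_space D {0<..}"
  \<comment> \<open>Since \<open>Z\<close> is almost surely positive, the half-line has full mass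
    under \<open>D\<close>, so the restriction still has total mass 1.\<close>
  interpret R: prob_space R
    unfolding R_def
    by (rule prob_space_restrict_space)
      (use D.prob_eq_1[of "{0<..}"] D_pos in \<open>auto simp: D.emeasure_eq_measure\<close>)
  have mix: "mixture G ?K = R \<bind> ?K"
    by (simp add: mixture_def G R_def D.interval_measure_cdf flip: D_def)
  have sets_R: "sets R = sets (restrict_space borel {0<..})"
    by (simp add: R_def sets_restrict_space)
  have R: "R \<in> space (prob_algebra (restrict_space borel {0<..}))"
    by (simp add: space_prob_algebra sets_R R.prob_space_axioms)
  have K_R: "?K \<in> R \<rightarrow>\<^sub>M subprob_algebra borel"
    using measurable_prob_algebraD[OF K] by (simp add: sets_R cong: measurable_cong_sets)
  have "measure (R \<bind> ?K) {..x} = at_neg_log \<phi> (H x)" for x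
  proof -
    have "measure (R \<bind> ?K) {..x} = (\<integral>s. measure (?K s) {..x} \<partial>R)"
      by (rule R.measure_bind[OF K_R]) simp
    \<comment> \<open>The kernel is known only for \<open>s > 0\<close>, so it is replaced by the
      power while still integrating over \<open>R\<close>. The power makes sense for all real
      \<open>s\<close>, which allows the passage to \<open>D\<close>.\<close>
    also have "\<dots> = (\<integral>s. H x powr s \<partial>R)"
      using K_cdf
      by (intro Bochner_Integration.integral_cong) (simp_all add: R_def space_restrict_space)
    also have "\<dots> = (\<integral>s. indicator {0<..} s *\<^sub>R H x powr s \<partial>D)"
      unfolding R_def by (rule integral_restrict_space) simp
    \<comment> \<open>The indicator equals 1 almost everywhere, again by positivity of
      \<open>Z\<close>.\<close>
    also have "\<dots> = (\<integral>s. H x powr s \<partial>D)"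
    proof (rule integral_cong_AE)
      show "AE s in D. indicator {0<..} s *\<^sub>R H x powr s = H x powr s"
        using D_pos by eventually_elim simp
    qed simp_all
    also have "\<dots> = (\<integral>\<omega>. H x powr Z \<omega> \<partial>M)"
      unfolding D_def using Z(1) by (rule integral_distr) simp
    finally show ?thesis
      by (simp add: \<phi> at_neg_log_laplace_transform)
  qed
  then show "has_distribution_function (mixture G ?K) (\<lambda>x. at_neg_log \<phi> (H x))"
    using prob_space_bind'[OF R K] sets_bind'[OF R K]
    by (simp add: has_distribution_function_def mix)
qed

end
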